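(* Let $r$ be a nonnegative integer. The Jordan form of the matrix $A_r$ is $$A_r = P_r J_r P_r^{-1},$$ where $P_r$, $J_r$, $P_r^{-1}$ are the $(r+2)\times(r+2)$ matrices given as follows. $P_r$: for $1\le j\le r$ the $j$th column of $P_r$ is the standard basis vector $e_j$; for $1\le i\le r+1$, $$(P_r)_{i,r+1}=\frac{\overline{\varphi}}{(-\varphi)^{r+1-i}},\qquad (P_r)_{i,r+2}=\frac{\varphi}{(-\overline{\varphi})^{r+1-i}},$$ and $(P_r)_{r+2,r+1}=(P_r)_{r+2,r+2}=1$. $J_r$: the block-diagonal matrix $J_r=\operatorname{diag}\bigl(J_r(1),\,\overline{\varphi},\,\varphi\bigr)$, where $J_r(1)$ is the $r\times r$ Jordan block with eigenvalue $1$ (ones on the diagonal and on the superdiagonal, zeros elsewhere; absent if $r=0$). $P_r^{-1}$: the matrix $P_r$ is invertible, and its inverse has $j$th column $e_j$ for $1\le j\le r$; for $1\le i\le r$, $$(P_r^{-1})_{i,r+1}=-F_{r-i+2},\qquad (P_r^{-1})_{i,r+2}=-F_{r-i+1},$$ and $$(P_r^{-1})_{r+1,r+1}=-\tfrac{1}{\sqrt5},\quad (P_r^{-1})_{r+1,r+2}=\tfrac{\varphi}{\sqrt5},\quad (P_r^{-1})_{r+2,r+1}=\tfrac{1}{\sqrt5},\quad (P_r^{-1})_{r+2,r+2}=-\tfrac{\overline{\varphi}}{\sqrt5}.$$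
   Context: $F_n$ denotes the Fibonacci numbers, $F_0=0$, $F_1=1$, $F_{n}=F_{n-1}+F_{n-2}$ for $n\ge 2$. $\varphi=\frac{1+\sqrt5}{2}$ and $\overline{\varphi}=\frac{1-\sqrt5}{2}$. For a nonnegative integer $r$, $A_r$ is the $(r+2)\times(r+2)$ matrix with $(A_r)_{i,i}=(A_r)_{i,i+1}=1$ for $1\le i\le r+1$, $(A_r)_{r+2,r+1}=1$, and all other entries $0$. *)

theory Defs
  imports
    "HOL-Number_Theory.Fib"
    "Jordan_Normal_Form.Jordan_Normal_Form"
begin

definition golden :: real where
  "golden = (1 + sqrt 5) / 2"

definition golden_conj :: real where
  "golden_conj = (1 - sqrt 5) / 2"

(* The library indexes matrices from 0.  In sq_mat n f the entry function f is
   1-based: f i j is the entry in row i, column j, for i and j in {1..n}.  Below, every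
   natural-number subtraction is evaluated only where it does not truncate. *)
definition sq_mat :: "nat \<Rightarrow> (nat \<Rightarrow> nat \<Rightarrow> real) \<Rightarrow> real mat" where
  "sq_mat n f = mat n n (\<lambda>(i, j). f (i + 1) (j + 1))"

definition A_mat :: "nat \<Rightarrow> real mat" where
  "A_mat r = sq_mat (r + 2) (\<lambda>i j.
     if i \<le> r + 1 \<and> (j = i \<or> j = i + 1) then 1
     else if i = r + 2 \<and> j = r + 1 then 1
     else 0)"

definition P_mat :: "nat \<Rightarrow> real mat" where
  "P_mat r = sq_mat (r + 2) (\<lambda>i j.
     if j \<le> r then (if i = j then 1 else 0)
     else if i = r + 2 then 1
     else if j = r + 1 then golden_conj / (- golden) ^ (r + 1 - i)
     else golden / (- golden_conj) ^ (r + 1 - i))"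

(* The block for the eigenvalue 1 is omitted when r = 0, since jordan_nf does not
   admit blocks of size 0. *)
definition J_blocks :: "nat \<Rightarrow> (nat \<times> real) list" where
  "J_blocks r = (if r = 0 then [] else [(r, 1)]) @ [(1, golden_conj), (1, golden)]"

definition J_mat :: "nat \<Rightarrow> real mat" where
  "J_mat r = jordan_matrix (J_blocks r)"

definition P_inv_mat :: "nat \<Rightarrow> real mat" where
  "P_inv_mat r = sq_mat (r + 2) (\<lambda>i j.
     if j \<le> r then (if i = j then 1 else 0)
     else if i \<le> r then
       (if j = r + 1 then - real (fib (r - i + 2)) else - real (fib (r - i + 1)))
     else if i = r + 1 then
       (if j = r + 1 then - (1 / sqrt 5) else golden / sqrt 5)
     else
       (if j = r + 1 then 1 / sqrt 5 else - (golden_conj / sqrt 5)))"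

end

theory Submission
  imports Defs
begin

text \<open>
  Each root of \<open>x\<^sup>2 = x + 1\<close> is minus the reciprocal of the other, so the last two columns of \<open>P\<close>
  consist of the descending powers \<open>x\<^bsup>r+1\<^esup>, \<dots>, x, 1\<close> of the roots. As
  \<open>x\<^bsup>n+1\<^esup> + x\<^bsup>n\<^esup> = x \<cdot> x\<^bsup>n+1\<^esup>\<close>, these are eigenvectors of \<open>A\<close>, which gives \<open>A P = P J\<close>.
  The nontrivial entries of \<open>P P\<^sup>-\<^sup>1 = 1\<close> are instances of Binet's formula.
\<close>

lemma golden_mult: "golden * golden_conj = -1"
  and golden_diff: "golden - golden_conj = sqrt 5"
  by (auto simp: golden_def golden_conj_def field_simps)

lemma golden_square: "golden * golden = golden + 1"
  and golden_conj_square: "golden_conj * golden_conj = golden_conj + 1"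
  by (auto simp: golden_def golden_conj_def field_simps)

lemma golden_conj_div_power: "golden_conj / (- golden) ^ n = golden_conj ^ Suc n"
proof -
  have "golden_conj * (- golden) = 1"
    using golden_mult by (simp add: mult.commute)
  then have "golden_conj ^ n * (- golden) ^ n = 1" "golden \<noteq> 0"
    by (auto simp flip: power_mult_distrib)
  then show ?thesis by (simp add: field_simps)
qed

lemma golden_div_power: "golden / (- golden_conj) ^ n = golden ^ Suc n"
proof -
  have "golden * (- golden_conj) = 1"
    using golden_mult by simp
  then have "golden ^ n * (- golden_conj) ^ n = 1" "golden_conj \<noteq> 0"
    by (auto simp flip: power_mult_distrib)
  then show ?thesis by (simp add: field_simps)
qed

lemma binet: "real (fib n) = (golden ^ n - golden_conj ^ n) / sqrt 5"
  unfolding golden_def golden_conj_def by (rule fib_closed_form)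

text \<open>Since the roots multiply to -1, pulling one factor of each out of the mixed products
  lowers the exponents and flips the sign in Binet's formula. This is the combination that the last
  column of \<open>P_inv_mat\<close> produces.\<close>

lemma binet_pred:
  "real (fib n) = (golden * golden_conj ^ Suc n - golden_conj * golden ^ Suc n) / sqrt 5"
proof -
  have "golden * golden_conj ^ Suc n - golden_conj * golden ^ Suc n
      = golden * golden_conj * (golden_conj ^ n - golden ^ n)"
    by (simp add: algebra_simps)
  then show ?thesis by (simp only: binet golden_mult) simp
qed

text \<open>With indices from 0, the last row \<open>i = r + 1\<close> has exponent 0, so its ones
  need no separate case.\<close>

lemma P_mat_index:
  assumes "i < r + 2" "k < r + 2"
  shows "P_mat r $$ (i, k) = (if k < r then of_bool (i = k)
    else if k = r then golden_conj ^ (r + 1 - i) else golden ^ (r + 1 - i))"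
  using assms golden_div_power[of "r - i"] golden_conj_div_power[of "r - i"]
  by (auto simp: P_mat_def sq_mat_def Suc_diff_le)

text \<open>The test \<open>j < r\<close> keeps the block for the eigenvalue 1 apart from the two
  roots and is void for \<open>r = 0\<close>, so both shapes of \<open>J_blocks\<close> are
  covered.\<close>

lemma J_mat_index:
  assumes "i < r + 2" "j < r + 2"
  shows "J_mat r $$ (i, j) = (if j < r then of_bool (i = j \<or> Suc i = j)
    else if i = j then (if j = r then golden_conj else golden) else 0)"
  using assms
  by (auto simp: J_mat_def J_blocks_def jordan_matrix_def Let_def)

lemma carrier_mats:
  "A_mat r \<in> carrier_mat (r + 2) (r + 2)" "P_mat r \<in> carrier_mat (r + 2) (r + 2)"
  "J_mat r \<in> carrier_mat (r + 2) (r + 2)" "P_inv_mat r \<in> carrier_mat (r + 2) (r + 2)"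
  by (auto simp: A_mat_def P_mat_def J_mat_def P_inv_mat_def sq_mat_def J_blocks_def)

lemma index_mult_sum:
  assumes "A \<in> carrier_mat n m" "B \<in> carrier_mat m k" "i < n" "j < k"
  shows "(A * B) $$ (i, j) = (\<Sum>l<m. A $$ (i, l) * B $$ (l, j))"
  using assms by (auto simp: scalar_prod_def atLeast0LessThan intro!: sum.cong)

text \<open>The first \<open>r\<close> columns of \<open>P_mat r\<close> are standard basis vectors,
  so their part of the sum collapses to a single entry.\<close>

lemma P_mult_index:
  assumes B: "B \<in> carrier_mat (r + 2) (r + 2)" and ij: "i < r + 2" "j < r + 2"
  shows "(P_mat r * B) $$ (i, j) = (if i < r then B $$ (i, j) else 0)
    + golden_conj ^ (r + 1 - i) * B $$ (r, j) + golden ^ (r + 1 - i) * B $$ (r + 1, j)"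
proof -
  have "(P_mat r * B) $$ (i, j) = (\<Sum>l<r + 2. P_mat r $$ (i, l) * B $$ (l, j))"
    by (rule index_mult_sum) (fact carrier_mats B ij)+
  also have "\<dots> = (\<Sum>l<r. P_mat r $$ (i, l) * B $$ (l, j))
      + P_mat r $$ (i, r) * B $$ (r, j) + P_mat r $$ (i, r + 1) * B $$ (r + 1, j)"
    by simp
  also have "(\<Sum>l<r. P_mat r $$ (i, l) * B $$ (l, j)) = (\<Sum>l<r. if i = l then B $$ (l, j) else 0)"
    using ij by (intro sum.cong) (auto simp: P_mat_index)
  finally show ?thesis using ij by (simp add: P_mat_index)
qed

lemma A_mult_index:
  assumes B: "B \<in> carrier_mat (r + 2) (r + 2)" and ij: "i < r + 2" "j < r + 2"
  shows "(A_mat r * B) $$ (i, j) =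
    (if i = r + 1 then B $$ (r, j) else B $$ (i, j) + B $$ (i + 1, j))"
proof -
  have "(A_mat r * B) $$ (i, j) = (\<Sum>l<r + 2. A_mat r $$ (i, l) * B $$ (l, j))"
    by (rule index_mult_sum) (fact carrier_mats B ij)+
  \<comment> \<open>Each conditional tests a single index against \<open>l\<close>, so that every
    sum collapses to one term.\<close>
  also have "\<dots> = (\<Sum>l<r + 2. if i = r + 1 then (if r = l then B $$ (l, j) else 0)
      else (if i = l then B $$ (l, j) else 0) + (if i + 1 = l then B $$ (l, j) else 0))"
    using ij by (intro sum.cong) (auto simp: A_mat_def sq_mat_def)
  also have "\<dots> = (if i = r + 1 then B $$ (r, j) else B $$ (i, j) + B $$ (i + 1, j))"
    using ij by (simp add: sum.distrib del: sum.lessThan_Suc)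
  finally show ?thesis .
qed

lemma P_inv_mat_index:
  assumes "i < r + 2" "j < r + 2"
  shows "P_inv_mat r $$ (i, j) = (if j < r then of_bool (i = j)
    else if i < r then (if j = r then - real (fib (Suc (r - i))) else - real (fib (r - i)))
    else if i = r then (if j = r then - (1 / sqrt 5) else golden / sqrt 5)
    else (if j = r then 1 / sqrt 5 else - (golden_conj / sqrt 5)))"
  using assms by (auto simp: P_inv_mat_def sq_mat_def Suc_diff_Suc)

lemma P_mult_P_inv: "P_mat r * P_inv_mat r = 1\<^sub>m (r + 2)"
proof (rule eq_matI)
  fix i j assume "i < dim_row (1\<^sub>m (r + 2) :: real mat)" "j < dim_col (1\<^sub>m (r + 2) :: real mat)"
  then have ij: "i < r + 2" "j < r + 2" by auto
  \<comment> \<open>This is the diagonal entry of the product in each of the last two rows; the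
    off-diagonal entries there cancel.\<close>
  have unit: "golden / sqrt 5 - golden_conj / sqrt 5 = 1"
    by (simp add: golden_diff flip: diff_divide_distrib)
  consider "i < r" | "i = r" | "i = r + 1" using ij by linarith
  then have "(if i < r then P_inv_mat r $$ (i, j) else 0)
    + golden_conj ^ (r + 1 - i) * P_inv_mat r $$ (r, j)
    + golden ^ (r + 1 - i) * P_inv_mat r $$ (r + 1, j) = of_bool (i = j)"
  proof cases
    case 1
    then have power: "r + 1 - i = Suc (r - i)" by simp
    show ?thesis
    proof (cases "j < r")
      case False
      then have "j = r \<or> j = r + 1" using ij by linarith
      \<comment> \<open>Column \<open>r\<close> is cancelled by Binet's formula at
        \<open>Suc (r - i)\<close>, column \<open>r + 1\<close> by its shifted form at
        \<open>r - i\<close>.\<close>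
      then show ?thesis
        unfolding power using 1 ij binet[of "Suc (r - i)"] binet_pred[of "r - i"]
        by (auto simp: P_inv_mat_index diff_divide_distrib mult.commute simp del: power_Suc fib.simps)
    qed (use 1 ij in \<open>simp add: P_inv_mat_index\<close>)
  qed (use ij unit in \<open>auto simp: P_inv_mat_index\<close>)
  then show "(P_mat r * P_inv_mat r) $$ (i, j) = 1\<^sub>m (r + 2) $$ (i, j)"
    using ij by (simp add: P_mult_index[OF carrier_mats(4) ij] del: index_mult_mat)
qed (auto simp: P_mat_def P_inv_mat_def sq_mat_def)

text \<open>In the first \<open>r\<close> columns both sides are the Jordan block for 1 padded with
  zeros; only the two eigenvector columns use the quadratic equation.\<close>

lemma A_mult_P: "A_mat r * P_mat r = P_mat r * J_mat r"
proof (rule eq_matI)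
  fix i j assume "i < dim_row (P_mat r * J_mat r)" "j < dim_col (P_mat r * J_mat r)"
  then have ij: "i < r + 2" "j < r + 2" using carrier_mats[of r] by auto
  have "(if i = r + 1 then P_mat r $$ (r, j) else P_mat r $$ (i, j) + P_mat r $$ (i + 1, j))
    = (if i < r then J_mat r $$ (i, j) else 0)
    + golden_conj ^ (r + 1 - i) * J_mat r $$ (r, j) + golden ^ (r + 1 - i) * J_mat r $$ (r + 1, j)"
  proof (cases "i = r + 1")
    case False
    then have power: "Suc r - i = Suc (r - i)" using ij by auto
    have step: "x ^ Suc n + x ^ n = x ^ Suc n * x" if "x * x = x + 1" for x :: real and n
    proof -
      have "x ^ Suc n + x ^ n = x ^ n * (x * x)" by (simp add: that algebra_simps)
      then show ?thesis by (simp add: mult_ac)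
    qed
    \<comment> \<open>In the eigenvector columns, rows \<open>i\<close> and \<open>i + 1\<close>
      carry the exponents \<open>Suc (r - i)\<close> and \<open>r - i\<close>, hence the choice of
      \<open>n\<close>.\<close>
    show ?thesis
      using False ij step[OF golden_square, of "r - i"] step[OF golden_conj_square, of "r - i"]
      by (auto simp: P_mat_index J_mat_index power simp del: power_Suc)
  qed (use ij in \<open>auto simp: P_mat_index J_mat_index\<close>)
  then show "(A_mat r * P_mat r) $$ (i, j) = (P_mat r * J_mat r) $$ (i, j)"
    by (simp only: A_mult_index[OF carrier_mats(2) ij] P_mult_index[OF carrier_mats(3) ij])
qed (use carrier_mats[of r] in auto)

theorem proposition3:
  fixes r :: nat
  shows "jordan_nf (A_mat r) (J_blocks r)
    \<and> {A_mat r, P_mat r, J_mat r, P_inv_mat r} \<subseteq> carrier_mat (r + 2) (r + 2)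
    \<and> invertible_mat (P_mat r)
    \<and> P_mat r * P_inv_mat r = 1\<^sub>m (r + 2)
    \<and> P_inv_mat r * P_mat r = 1\<^sub>m (r + 2)
    \<and> A_mat r = P_mat r * J_mat r * P_inv_mat r"
proof (intro conjI)
  show right_inv: "P_mat r * P_inv_mat r = 1\<^sub>m (r + 2)" by (rule P_mult_P_inv)
  \<comment> \<open>A right inverse of a square matrix over a field is also a left inverse.\<close>
  show left_inv: "P_inv_mat r * P_mat r = 1\<^sub>m (r + 2)"
    by (rule mat_mult_left_right_inverse[OF _ _ right_inv]) (rule carrier_mats)+
  have "P_mat r * J_mat r * P_inv_mat r = A_mat r * (P_mat r * P_inv_mat r)"
    by (simp add: assoc_mult_mat[OF carrier_mats(1,2,4)] flip: A_mult_P)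
  then show decomp: "A_mat r = P_mat r * J_mat r * P_inv_mat r"
    using right_mult_one_mat[OF carrier_mats(1)[of r]] by (simp add: right_inv)
  show subset: "{A_mat r, P_mat r, J_mat r, P_inv_mat r} \<subseteq> carrier_mat (r + 2) (r + 2)"
    by (simp only: insert_subset carrier_mats empty_subsetI simp_thms)
  show "invertible_mat (P_mat r)"
    unfolding invertible_mat_def inverts_mat_def square_mat.simps
    using left_inv right_inv carrier_matD[OF carrier_mats(2)[of r]] carrier_matD[OF carrier_mats(4)[of r]] by auto
  have "similar_mat (A_mat r) (J_mat r)"
    by (rule similar_matI[OF _ right_inv left_inv decomp]) (use subset in blast)
  \<comment> \<open>Besides similarity, \<open>jordan_nf\<close> asks for nonzero block sizes, which
    the case split in \<open>J_blocks\<close> ensures.\<close>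
  then show "jordan_nf (A_mat r) (J_blocks r)"
    by (auto simp: jordan_nf_def J_blocks_def J_mat_def)
qed

end
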